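(* Consider the nominal system $\dot p_{\mathrm n}=v_{\mathrm n}$, $\dot v_{\mathrm n}=u_{\mathrm n}$ and the attacked system $\dot p=v$, $\dot v=u$ in $\mathbb{R}^2$, with equal initial conditions $p(0)=p_{\mathrm n}(0)$, $v(0)=v_{\mathrm n}(0)$, and let $u^{\mathrm{GNSS}}:\mathbb{R}_{\ge 0}\to\mathbb{R}^2$ be the GNSS spoofing signal. The attack $(u,u^{\mathrm{GNSS}})$ is undetectable if and only if, at all times, $$u^{\mathsf T}p=u_{\mathrm n}^{\mathsf T}p_{\mathrm n}+\|v_{\mathrm n}\|^2-\|v\|^2\quad\text{and}\quad u^{\mathrm{GNSS}}=p_{\mathrm n}-p .$$
   Context: Nominal robot: position $p_{\mathrm n}:\mathbb{R}_{\ge0}\to\mathbb{R}^2$, velocity $v_{\mathrm n}:\mathbb{R}_{\ge0}\to\mathbb{R}^2$, nominal control $u_{\mathrm n}:\mathbb{R}_{\ge0}\to\mathbb{R}^2$ piecewise continuous with $\|u_{\mathrm n}\|\le u_{\max}$, where $u_{\max}>0$; dynamics $\dot p_{\mathrm n}=v_{\mathrm n}$, $\dot v_{\mathrm n}=u_{\mathrm n}$. Nominal measurements: $y^{\mathrm{GNSS}}_{\mathrm n}=p_{\mathrm n}$ and $y^{\mathrm{RSSI}}_{\mathrm n}=p_{\mathrm n}^{\mathsf T}p_{\mathrm n}$. Attacked robot: position $p$, velocity $v$, attacked control $u$ (piecewise continuous, $\|u\|\le u_{\max}$), dynamics $\dot p=v$, $\dot v=u$. Measurements under attack: $y^{\mathrm{GNSS}}=p+u^{\mathrm{GNSS}}$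 and $y^{\mathrm{RSSI}}=p^{\mathsf T}p$. It is assumed that $p(0)=p_{\mathrm n}(0)$ and $v(0)=v_{\mathrm n}(0)$. Undetectable attack: $(u,u^{\mathrm{GNSS}})$ is undetectable if $y^{\mathrm{GNSS}}=y^{\mathrm{GNSS}}_{\mathrm n}$ and $y^{\mathrm{RSSI}}=y^{\mathrm{RSSI}}_{\mathrm n}$ at all times; it is detectable otherwise. Convention: the differential equations for the velocities, and identities involving the inputs $u,u_{\mathrm n}$, are understood at all times outside the discrete set of discontinuity points of the piecewise continuous inputs. *)

theory Defs
  imports "HOL-Analysis.Analysis"
begin

text \<open>
  The time axis is \<open>{0..}\<close>. Signals are total functions on \<open>real\<close>; their values at negative
  times are irrelevant, so continuity and derivatives are always taken within \<open>{0..}\<close>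
  (one-sided at time 0).
\<close>

definition discontinuities :: "(real \<Rightarrow> 'a::topological_space) \<Rightarrow> real set" where
  "discontinuities f = {t. 0 \<le> t \<and> \<not> continuous (at t within {0..}) f}"

definition piecewise_continuous :: "(real \<Rightarrow> 'a::topological_space) \<Rightarrow> bool" where
  "piecewise_continuous f \<longleftrightarrow>
     (\<forall>T. finite (discontinuities f \<inter> {0..T})) \<and>
     (\<forall>t\<ge>0. \<exists>l. (f \<longlongrightarrow> l) (at_right t)) \<and>
     (\<forall>t>0. \<exists>l. (f \<longlongrightarrow> l) (at_left t))"

text \<open>
  Trajectories of the double integrator with admissible control \<open>u\<close>. The velocity equation is
  imposed only off the discontinuities of \<open>u\<close>. Continuity of \<open>v\<close> at those points is not imposed
  separately: \<open>v\<close> is everywhere the derivative of \<open>p\<close>, so it has no jumps, and it is Lipschitz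
  between discontinuities of \<open>u\<close>.
\<close>

definition robot_trajectory ::
  "real \<Rightarrow> (real \<Rightarrow> real^2) \<Rightarrow> (real \<Rightarrow> real^2) \<Rightarrow> (real \<Rightarrow> real^2) \<Rightarrow> bool" where
  "robot_trajectory umax p v u \<longleftrightarrow>
     piecewise_continuous u \<and>
     (\<forall>t\<ge>0. norm (u t) \<le> umax) \<and>
     (\<forall>t\<ge>0. (p has_vector_derivative v t) (at t within {0..})) \<and>
     (\<forall>t\<in>{0..} - discontinuities u. (v has_vector_derivative u t) (at t within {0..}))"

definition gnss_nominal :: "(real \<Rightarrow> real^2) \<Rightarrow> real \<Rightarrow> real^2" where
  "gnss_nominal pn t = pn t"

definition gnss_attacked :: "(real \<Rightarrow> real^2) \<Rightarrow> (real \<Rightarrow> real^2) \<Rightarrow> real \<Rightarrow> real^2" where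
  "gnss_attacked p u_gnss t = p t + u_gnss t"

definition rssi :: "(real \<Rightarrow> real^2) \<Rightarrow> real \<Rightarrow> real" where
  "rssi p t = p t \<bullet> p t"

text \<open>
  The attacked control enters this predicate through the position \<open>p\<close> it generates from the
  given initial state.
\<close>

definition undetectable ::
  "(real \<Rightarrow> real^2) \<Rightarrow> (real \<Rightarrow> real^2) \<Rightarrow> (real \<Rightarrow> real^2) \<Rightarrow> bool" where
  "undetectable pn p u_gnss \<longleftrightarrow>
     (\<forall>t\<ge>0. gnss_attacked p u_gnss t = gnss_nominal pn t \<and> rssi p t = rssi pn t)"

end

theory Submission
  imports Defs
begin

text \<open>
  Let \<open>h = p \<bullet> p - pn \<bullet> pn\<close> be the RSSI residual and let \<open>g = p \<bullet> v - pn \<bullet> vn\<close>. Then \<open>h\<close> has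
  derivative \<open>2 g\<close> at every time, and off the discontinuities of the inputs \<open>g\<close> has derivative
  \<open>u \<bullet> p + (norm v)\<^sup>2 - un \<bullet> pn - (norm vn)\<^sup>2\<close>, which vanishes exactly when the control identity of the
  theorem holds. The theorem therefore says that \<open>h\<close> vanishes iff its second derivative does at
  all times where the inputs are continuous, the initial values \<open>h 0 = g 0 = 0\<close> being given by
  the common initial state; the condition on the spoofing signal merely restates the equality of
  the GNSS outputs.

  If \<open>h\<close> vanishes, then so do \<open>g\<close> and its derivative, by uniqueness of derivatives. For the
  converse, a vanishing derivative of \<open>g\<close> makes \<open>g\<close> constant only between consecutive
  discontinuities of the inputs, and a jump of \<open>g\<close> at such a time has to be excluded. It is
  excluded because \<open>g\<close> is, up to a factor, the derivative of \<open>h\<close> everywhere: on each gap \<open>h\<close> is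
  affine, so the slopes of \<open>h\<close> on two adjacent gaps both equal its derivative at the common
  endpoint. This is the content of \<open>derivative_constant_up_to_endpoints\<close> and
  \<open>derivative_eq_if_zero_derivative_off_finite\<close>.
\<close>

text \<open>
  The value at an endpoint is forced because \<open>h\<close> is continuous there, hence affine on the closed
  interval, and its one-sided derivative at the endpoint is the slope.
\<close>

lemma derivative_constant_up_to_endpoints:
  fixes h g :: "real \<Rightarrow> real"
  assumes "a < b"
    and h: "\<And>t. t \<in> {a..b} \<Longrightarrow> (h has_real_derivative g t) (at t within {a..b})"
    and c: "\<And>t. t \<in> {a<..<b} \<Longrightarrow> g t = c"
    and "t \<in> {a..b}"
  shows "g t = c"
proof -
  define k where "k = h a - c * a"
  have affine: "h x = k + c * x" if "x \<in> {a..b}" for x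
  proof -
    have "h x - c * x = h a - c * a"
    proof (rule DERIV_isconst2[of a b])
      show "continuous_on {a..b} (\<lambda>x. h x - c * x)"
        using h by (intro continuous_intros DERIV_continuous_on) auto
      fix y assume y: "a < y" "y < b"
      then have "(h has_real_derivative c) (at y)"
        using h[of y] c[of y] by (simp add: at_within_Icc_at)
      then show "((\<lambda>x. h x - c * x) has_real_derivative 0) (at y)"
        by (auto intro!: derivative_eq_intros)
    qed (use assms(1) that in auto)
    then show ?thesis by (simp add: k_def)
  qed
  have "((\<lambda>x. k + c * x) has_real_derivative c) (at t within {a..b})"
    by (auto intro!: derivative_eq_intros)
  then have "(h has_real_derivative c) (at t within {a..b})"
    by (rule has_field_derivative_transform_within[where d = 1]) (use affine \<open>t \<in> {a..b}\<close> in auto)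
  then show ?thesis
    using vector_derivative_unique_within_closed_interval[of a b t h "g t" c] assms(1,4) h[of t]
    by (simp add: has_real_derivative_iff_has_vector_derivative)
qed

text \<open>
  The hypothesis that \<open>g\<close> is itself a derivative replaces the continuity of \<open>g\<close> at the exceptional
  points. Each exceptional point inside the interval splits it in two, which is the induction on
  the exceptional set.
\<close>

lemma derivative_eq_if_zero_derivative_off_finite:
  fixes h g :: "real \<Rightarrow> real"
  assumes "finite D" and "a \<le> b"
    and "\<And>t. t \<in> {a..b} \<Longrightarrow> (h has_real_derivative g t) (at t within {a..b})"
    and "\<And>t. t \<in> {a<..<b} - D \<Longrightarrow> (g has_real_derivative 0) (at t)"
  shows "g b = g a"
  using assms
proof (induction D arbitrary: a b rule: finite_induct)
  case empty
  show ?case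
  proof (cases "a = b")
    case False
    then have "a < b" using empty.prems(1) by simp
    have "\<exists>c. \<forall>t\<in>{a<..<b}. g t = c"
      using empty.prems(3)
      by (intro has_field_derivative_zero_constant convex_real_interval)
        (auto intro: has_field_derivative_at_within)
    then obtain c where c: "\<And>t. t \<in> {a<..<b} \<Longrightarrow> g t = c" by blast
    have "g a = c" "g b = c"
      using derivative_constant_up_to_endpoints[OF \<open>a < b\<close> empty.prems(2) c] \<open>a < b\<close> by auto
    then show ?thesis by simp
  qed simp
next
  case (insert d D)
  have sub: "(h has_real_derivative g t) (at t within {a'..b'})"
    if "t \<in> {a'..b'}" "{a'..b'} \<subseteq> {a..b}" for t a' b'
    using insert.prems(2) that by (blast intro: DERIV_subset)
  show ?case
  proof (cases "d \<in> {a<..<b}")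
    case True
    have "g d = g a" by (rule insert.IH) (use True sub insert.prems(3) in auto)
    moreover have "g b = g d" by (rule insert.IH) (use True sub insert.prems(3) in auto)
    ultimately show ?thesis by simp
  next
    case False
    show ?thesis by (rule insert.IH) (use False insert.prems in auto)
  qed
qed

text \<open>This makes one-sided derivatives unique at every time, including time 0.\<close>

lemma nontrivial_at_within_atLeast:
  fixes t :: real
  assumes "0 \<le> t"
  shows "at t within {0..} \<noteq> bot"
proof -
  have "at t within {t..t + 1} \<le> at t within {0..}"
    using assms by (intro at_le) auto
  moreover have "at t within {t..t + 1} \<noteq> bot"
    by (simp add: at_within_Icc_at_right)
  ultimately show ?thesis by (metis le_bot)
qed

lemma rssi_has_derivative:
  assumes "robot_trajectory umax p v u" and "0 \<le> t"
  shows "(rssi p has_real_derivative 2 * (p t \<bullet> v t)) (at t within {0..})"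
proof -
  have "(p has_vector_derivative v t) (at t within {0..})"
    using assms by (auto simp: robot_trajectory_def)
  from bounded_bilinear.has_vector_derivative[OF bounded_bilinear_inner this this]
  show ?thesis
    by (simp add: has_real_derivative_iff_has_vector_derivative rssi_def[abs_def] inner_commute)
qed

lemma position_velocity_inner_has_derivative:
  assumes "robot_trajectory umax p v u" and "0 \<le> t" and "t \<notin> discontinuities u"
  shows "((\<lambda>t. p t \<bullet> v t) has_real_derivative u t \<bullet> p t + (norm (v t))\<^sup>2) (at t within {0..})"
proof -
  have "(p has_vector_derivative v t) (at t within {0..})"
    "(v has_vector_derivative u t) (at t within {0..})"
    using assms by (auto simp: robot_trajectory_def)
  from bounded_bilinear.has_vector_derivative[OF bounded_bilinear_inner this]
  show ?thesis
    by (simp add: has_real_derivative_iff_has_vector_derivative inner_commute power2_norm_eq_inner)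
qed

theorem theorem7:
  fixes pn vn un p v u u_gnss :: "real \<Rightarrow> real^2" and umax :: real
  assumes "umax > 0"
    and "robot_trajectory umax pn vn un"
    and "robot_trajectory umax p v u"
    and "p 0 = pn 0" and "v 0 = vn 0"
  shows "undetectable pn p u_gnss \<longleftrightarrow>
    (\<forall>t\<in>{0..} - (discontinuities u \<union> discontinuities un).
        u t \<bullet> p t = un t \<bullet> pn t + (norm (vn t))\<^sup>2 - (norm (v t))\<^sup>2) \<and>
    (\<forall>t\<ge>0. u_gnss t = pn t - p t)"
proof -
  let ?D = "discontinuities u \<union> discontinuities un"
  define h where "h t = rssi p t - rssi pn t" for t
  define g where "g t = p t \<bullet> v t - pn t \<bullet> vn t" for t
  define r where "r t = u t \<bullet> p t - (un t \<bullet> pn t + (norm (vn t))\<^sup>2 - (norm (v t))\<^sup>2)" for t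
  have h': "(h has_real_derivative 2 * g t) (at t within {0..})" if "0 \<le> t" for t
    using DERIV_diff[OF rssi_has_derivative[OF assms(3) that] rssi_has_derivative[OF assms(2) that]]
    by (simp add: h_def[abs_def] g_def algebra_simps)
  have g': "(g has_real_derivative r t) (at t within {0..})" if "0 \<le> t" "t \<notin> ?D" for t
    using DERIV_diff[OF position_velocity_inner_has_derivative[OF assms(3) that(1)]
        position_velocity_inner_has_derivative[OF assms(2) that(1)]] that(2)
    by (simp add: g_def[abs_def] r_def algebra_simps)
  have unique: "x = y"
    if "(f has_real_derivative x) (at t within {0..})"
      "(f has_real_derivative y) (at t within {0..})" "0 \<le> t" for f :: "real \<Rightarrow> real" and x y t
    using has_field_derivative_unique[OF that(1,2) nontrivial_at_within_atLeast[OF that(3)]] .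
  have zero_cong: "(f has_real_derivative 0) (at t within {0..})"
    if "\<And>s. 0 \<le> s \<Longrightarrow> f s = 0" "0 \<le> t" for f :: "real \<Rightarrow> real" and t
    by (rule has_field_derivative_transform_within[of "\<lambda>_. 0" 0 t _ 1]) (use that in auto)
  have "(\<forall>t\<ge>0. h t = 0) \<longleftrightarrow> (\<forall>t\<in>{0..} - ?D. r t = 0)"
  proof
    assume "\<forall>t\<ge>0. h t = 0"
    then have g0: "g t = 0" if "0 \<le> t" for t
      using unique[OF h' zero_cong[of h]] that by force
    then show "\<forall>t\<in>{0..} - ?D. r t = 0"
      using unique[OF g' zero_cong[of g]] by auto
  next
    assume r0: "\<forall>t\<in>{0..} - ?D. r t = 0"
    have g0: "g T = 0" if "0 \<le> T" for T
    proof -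
      have "2 * g T = 2 * g 0"
      proof (rule derivative_eq_if_zero_derivative_off_finite
          [where D = "?D \<inter> {0..T}" and h = h and g = "\<lambda>t. 2 * g t"])
        show "finite (?D \<inter> {0..T})"
          using assms(2,3) by (simp add: robot_trajectory_def piecewise_continuous_def Int_Un_distrib2)
        show "(h has_real_derivative 2 * g t) (at t within {0..T})" if "t \<in> {0..T}" for t
          using h'[of t] that by (auto intro: DERIV_subset)
        show "((\<lambda>t. 2 * g t) has_real_derivative 0) (at t)" if "t \<in> {0<..<T} - ?D \<inter> {0..T}" for t
        proof -
          have "(g has_real_derivative 0) (at t within {0..})"
            using g'[of t] r0 that by auto
          moreover have "at t within {0..} = at t"
            using that by (intro at_within_interior) auto
          ultimately show ?thesis
            by (auto intro!: derivative_eq_intros)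
        qed
      qed (use that in simp)
      then show ?thesis using assms(4,5) by (simp add: g_def)
    qed
    have "\<exists>c. \<forall>t\<in>{0..}. h t = c"
      using h' g0 by (intro has_field_derivative_zero_constant) force+
    then show "\<forall>t\<ge>0. h t = 0"
      using assms(4) by (force simp: h_def rssi_def)
  qed
  moreover have "p t + u_gnss t = pn t \<longleftrightarrow> u_gnss t = pn t - p t" for t
    by (auto simp: algebra_simps)
  ultimately show ?thesis
    by (auto simp: undetectable_def gnss_attacked_def gnss_nominal_def h_def r_def)
qed

end
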